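(* Let $A$ be a zero annihilator evolution algebra over a field $K$. Suppose $A=\bigoplus_{\alpha\in\Gamma}A_\alpha=\bigoplus_{\beta\in\Gamma'}A'_\beta$ are two direct sum decompositions of $A$, where all $A_\alpha$ and $A'_\beta$ are ideals of $A$, indecomposable as algebras on their own, with $\mathcal C(A_\alpha)\cong K$ and $\mathcal C(A'_\beta)\cong K$ for all $\alpha\in\Gamma$, $\beta\in\Gamma'$. Then the two decompositions agree up to reordering and isomorphism: there is a bijection $\sigma:\Gamma\to\Gamma'$ such that $A_\alpha\cong A'_{\sigma(\alpha)}$ as algebras for every $\alpha\in\Gamma$.
   Context: Algebras are not assumed associative. An evolution algebra over $K$ is a $K$-algebra $A$ having a basis $B=\{e_i\}_{i\in\Lambda}$ (a natural basis) with $e_ie_j=0$ for all $i\ne j$. $A$ is a zero annihilator algebra if $\{x\in A: xA=Ax=0\}=0$. An algebra is decomposable if it is a direct sum $I\oplus J$ of two nonzero ideals, and indecomposable otherwise. The centroid $\mathcal C(C)$ of a $K$-algebra $C$ is the set of all $K$-linear maps $T:C\to C$ with $T(xy)=xT(y)=T(x)y$ for all $x,y\in C$; it is a $K$-algebra under addition and composition. The isomorphisms $\mathcal C(A_\alpha)\cong K$ are of $K$-algebras. *)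

theory Defs
  imports Complex_Main "HOL-Library.FuncSet"
begin

text \<open>The ambient algebra is a whole type; its ideals, regarded as algebras in their
  own right, are subsets of that type.\<close>

locale nonassoc_algebra = vector_space scale
  for scale :: "'k::field \<Rightarrow> 'a::ab_group_add \<Rightarrow> 'a" +
  fixes mult :: "'a \<Rightarrow> 'a \<Rightarrow> 'a"
  assumes linear_mult_left: "Vector_Spaces.linear scale scale (\<lambda>x. mult x y)"
    and linear_mult_right: "Vector_Spaces.linear scale scale (\<lambda>y. mult x y)"

definition natural_basis ::
    "('k::field \<Rightarrow> 'a::ab_group_add \<Rightarrow> 'a) \<Rightarrow> ('a \<Rightarrow> 'a \<Rightarrow> 'a) \<Rightarrow> 'a set \<Rightarrow> bool" where
  "natural_basis scale mult B \<longleftrightarrow>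
     \<not> module.dependent scale B \<and> module.span scale B = UNIV \<and>
     (\<forall>e\<in>B. \<forall>f\<in>B. e \<noteq> f \<longrightarrow> mult e f = 0)"

locale evolution_algebra = nonassoc_algebra scale mult
  for scale :: "'k::field \<Rightarrow> 'a::ab_group_add \<Rightarrow> 'a" and mult :: "'a \<Rightarrow> 'a \<Rightarrow> 'a" +
  assumes ex_natural_basis: "\<exists>B. natural_basis scale mult B"

definition annihilator :: "('a::ab_group_add \<Rightarrow> 'a \<Rightarrow> 'a) \<Rightarrow> 'a set" where
  "annihilator mult = {x. \<forall>a. mult x a = 0 \<and> mult a x = 0}"

text \<open>\<open>I\<close> is a two-sided ideal of the algebra with underlying set \<open>C\<close>.\<close>

definition alg_ideal ::
    "('k::field \<Rightarrow> 'a::ab_group_add \<Rightarrow> 'a) \<Rightarrow> ('a \<Rightarrow> 'a \<Rightarrow> 'a) \<Rightarrow> 'a set \<Rightarrow> 'a set \<Rightarrow> bool" where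
  "alg_ideal scale mult C I \<longleftrightarrow>
     I \<subseteq> C \<and> module.subspace scale I \<and>
     (\<forall>x\<in>I. \<forall>c\<in>C. mult x c \<in> I \<and> mult c x \<in> I)"

definition decomposable ::
    "('k::field \<Rightarrow> 'a::ab_group_add \<Rightarrow> 'a) \<Rightarrow> ('a \<Rightarrow> 'a \<Rightarrow> 'a) \<Rightarrow> 'a set \<Rightarrow> bool" where
  "decomposable scale mult C \<longleftrightarrow>
     (\<exists>I J. alg_ideal scale mult C I \<and> alg_ideal scale mult C J \<and>
            I \<noteq> {0} \<and> J \<noteq> {0} \<and>
            C = {x + y | x y. x \<in> I \<and> y \<in> J} \<and> I \<inter> J = {0})"

text \<open>The type is the internal direct sum of the family \<open>F\<close> over the possibly infinite
  index set \<open>\<Gamma>\<close>: every element has a unique finitely supported family of components.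
  Components outside \<open>\<Gamma>\<close> are set to \<open>0\<close> so that uniqueness refers to \<open>\<Gamma>\<close> only.\<close>

definition is_direct_sum :: "'i set \<Rightarrow> ('i \<Rightarrow> 'a::ab_group_add set) \<Rightarrow> bool" where
  "is_direct_sum \<Gamma> F \<longleftrightarrow>
     (\<forall>x. \<exists>!u. (\<forall>\<alpha>\<in>\<Gamma>. u \<alpha> \<in> F \<alpha>) \<and> (\<forall>\<alpha>. \<alpha> \<notin> \<Gamma> \<longrightarrow> u \<alpha> = 0) \<and>
               finite {\<alpha>. u \<alpha> \<noteq> 0} \<and> x = (\<Sum>\<alpha> | u \<alpha> \<noteq> 0. u \<alpha>))"

text \<open>Ideals, centroids and the ground field live in different types, so algebras are
  compared as records.\<close>

record ('k, 'v) alg =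
  acarrier :: "'v set"
  aadd :: "'v \<Rightarrow> 'v \<Rightarrow> 'v"
  ascale :: "'k \<Rightarrow> 'v \<Rightarrow> 'v"
  amult :: "'v \<Rightarrow> 'v \<Rightarrow> 'v"

definition alg_isomorphic :: "('k, 'v) alg \<Rightarrow> ('k, 'w) alg \<Rightarrow> bool" where
  "alg_isomorphic X Y \<longleftrightarrow>
     (\<exists>f. bij_betw f (acarrier X) (acarrier Y) \<and>
          (\<forall>x\<in>acarrier X. \<forall>y\<in>acarrier X. f (aadd X x y) = aadd Y (f x) (f y)) \<and>
          (\<forall>c. \<forall>x\<in>acarrier X. f (ascale X c x) = ascale Y c (f x)) \<and>
          (\<forall>x\<in>acarrier X. \<forall>y\<in>acarrier X. f (amult X x y) = amult Y (f x) (f y)))"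

definition sub_alg ::
    "('k::field \<Rightarrow> 'a::ab_group_add \<Rightarrow> 'a) \<Rightarrow> ('a \<Rightarrow> 'a \<Rightarrow> 'a) \<Rightarrow> 'a set \<Rightarrow> ('k, 'a) alg" where
  "sub_alg scale mult C =
     \<lparr> acarrier = C, aadd = (+), ascale = scale, amult = mult \<rparr>"

definition field_alg :: "('k::field, 'k) alg" where
  "field_alg = \<lparr> acarrier = UNIV, aadd = (+), ascale = (*), amult = (*) \<rparr>"

text \<open>Maps \<open>C \<rightarrow> C\<close> are represented by functions extensional on \<open>C\<close>, so that equality in
  the centroid is equality of maps on \<open>C\<close>.\<close>

definition centroid ::
    "('k::field \<Rightarrow> 'a::ab_group_add \<Rightarrow> 'a) \<Rightarrow> ('a \<Rightarrow> 'a \<Rightarrow> 'a) \<Rightarrow> 'a set \<Rightarrow> ('a \<Rightarrow> 'a) set" where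
  "centroid scale mult C =
     {T \<in> C \<rightarrow>\<^sub>E C.
        (\<forall>x\<in>C. \<forall>y\<in>C. T (x + y) = T x + T y) \<and>
        (\<forall>c. \<forall>x\<in>C. T (scale c x) = scale c (T x)) \<and>
        (\<forall>x\<in>C. \<forall>y\<in>C. T (mult x y) = mult x (T y) \<and> T (mult x y) = mult (T x) y)}"

definition centroid_alg ::
    "('k::field \<Rightarrow> 'a::ab_group_add \<Rightarrow> 'a) \<Rightarrow> ('a \<Rightarrow> 'a \<Rightarrow> 'a) \<Rightarrow> 'a set \<Rightarrow> ('k, 'a \<Rightarrow> 'a) alg" where
  "centroid_alg scale mult C =
     \<lparr> acarrier = centroid scale mult C,
       aadd = (\<lambda>S T. \<lambda>x\<in>C. S x + T x),
       ascale = (\<lambda>c T. \<lambda>x\<in>C. scale c (T x)),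
       amult = compose C \<rparr>"

end

theory Submission
  imports Defs
begin

text \<open>The two families of ideals are in fact equal as sets of ideals, so the isomorphisms can
  be taken to be identity maps. Write \<open>p\<^sub>\<alpha>\<close> and \<open>q\<^sub>\<beta>\<close> for the projections of the two
  decompositions. Since the summands are ideals, every projection is a multiplier:
  \<open>q\<^sub>\<beta> (x y) = x q\<^sub>\<beta>(y) = q\<^sub>\<beta>(x) y\<close> (\<open>component_mult_left\<close>, \<open>component_mult_right\<close>). In
  an algebra with zero annihilator a multiplier maps every \<open>A\<^sub>\<alpha>\<close> into itself
  (\<open>multiplier_preserves_summand\<close>), because for \<open>x \<in> A\<^sub>\<alpha>\<close> and \<open>\<gamma> \<noteq> \<alpha>\<close> the element
  \<open>p\<^sub>\<gamma> (q\<^sub>\<beta> x)\<close> annihilates everything. Hence \<open>q\<^sub>\<beta>\<close> splits \<open>A\<^sub>\<alpha>\<close> into the two ideals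
  \<open>A\<^sub>\<alpha> \<inter> A'\<^sub>\<beta>\<close> and \<open>A\<^sub>\<alpha> \<inter> ker q\<^sub>\<beta>\<close>, and indecomposability makes one of them zero. Some
  \<open>q\<^sub>\<beta>\<close> does not vanish on \<open>A\<^sub>\<alpha> \<noteq> {0}\<close>, which gives \<open>A\<^sub>\<alpha> \<subseteq> A'\<^sub>\<beta>\<close>
  (\<open>indecomposable_ideal_in_summand\<close>). The same argument puts \<open>A'\<^sub>\<beta>\<close> inside some
  \<open>A\<^sub>\<delta>\<close>; distinct summands meet in zero, so \<open>\<delta> = \<alpha>\<close> and \<open>A\<^sub>\<alpha> = A'\<^sub>\<beta>\<close>.

  That the summands are nonzero comes from their centroids: the centroid of the zero algebra is a
  single map, whereas a field has at least two elements.\<close>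

section \<open>Projections of a decomposition into ideals\<close>

locale ideal_decomposition = nonassoc_algebra scale mult
  for scale :: "'k::field \<Rightarrow> 'a::ab_group_add \<Rightarrow> 'a" and mult :: "'a \<Rightarrow> 'a \<Rightarrow> 'a" +
  fixes \<Gamma> :: "'i set" and F :: "'i \<Rightarrow> 'a set"
  assumes ideal: "\<alpha> \<in> \<Gamma> \<Longrightarrow> alg_ideal scale mult UNIV (F \<alpha>)"
    and direct_sum: "is_direct_sum \<Gamma> F"
begin

definition components_of :: "'a \<Rightarrow> ('i \<Rightarrow> 'a) \<Rightarrow> bool" where
  "components_of x u \<longleftrightarrow>
     (\<forall>\<alpha>\<in>\<Gamma>. u \<alpha> \<in> F \<alpha>) \<and> (\<forall>\<alpha>. \<alpha> \<notin> \<Gamma> \<longrightarrow> u \<alpha> = 0) \<and>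
     finite {\<alpha>. u \<alpha> \<noteq> 0} \<and> x = (\<Sum>\<alpha> | u \<alpha> \<noteq> 0. u \<alpha>)"

definition component :: "'i \<Rightarrow> 'a \<Rightarrow> 'a" where
  "component \<alpha> x = (THE u. components_of x u) \<alpha>"

lemma ex1_components: "\<exists>!u. components_of x u"
  using direct_sum unfolding is_direct_sum_def components_of_def by blast

lemma components_of_component: "components_of x (\<lambda>\<alpha>. component \<alpha> x)"
  unfolding component_def by (rule theI'[OF ex1_components])

lemma component_eqI: "components_of x u \<Longrightarrow> component \<alpha> x = u \<alpha>"
  unfolding component_def by (simp add: the1_equality[OF ex1_components])

lemma component_in_summand: "\<alpha> \<in> \<Gamma> \<Longrightarrow> component \<alpha> x \<in> F \<alpha>"
  and component_outside: "\<alpha> \<notin> \<Gamma> \<Longrightarrow> component \<alpha> x = 0"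
  and finite_support: "finite {\<alpha>. component \<alpha> x \<noteq> 0}"
  and sum_components: "(\<Sum>\<alpha> | component \<alpha> x \<noteq> 0. component \<alpha> x) = x"
  using components_of_component[of x] unfolding components_of_def by auto

lemma summand_subspace: "\<alpha> \<in> \<Gamma> \<Longrightarrow> subspace (F \<alpha>)"
  and summand_mult_left: "\<alpha> \<in> \<Gamma> \<Longrightarrow> x \<in> F \<alpha> \<Longrightarrow> mult x y \<in> F \<alpha>"
  and summand_mult_right: "\<alpha> \<in> \<Gamma> \<Longrightarrow> x \<in> F \<alpha> \<Longrightarrow> mult y x \<in> F \<alpha>"
  using ideal unfolding alg_ideal_def by auto

lemma component_of_member:
  assumes "\<alpha> \<in> \<Gamma>" "x \<in> F \<alpha>"
  shows "component \<beta> x = (if \<beta> = \<alpha> then x else 0)"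
proof -
  have supp: "{\<gamma>. (if \<gamma> = \<alpha> then x else 0) \<noteq> 0} = (if x = 0 then {} else {\<alpha>})"
    by auto
  have "components_of x (\<lambda>\<gamma>. if \<gamma> = \<alpha> then x else 0)"
    using assms subspace_0[OF summand_subspace] unfolding components_of_def supp by auto
  then show ?thesis by (rule component_eqI)
qed

lemma summands_meet_trivially:
  assumes "\<alpha> \<in> \<Gamma>" "\<beta> \<in> \<Gamma>" "\<alpha> \<noteq> \<beta>" "x \<in> F \<alpha>" "x \<in> F \<beta>"
  shows "x = 0"
  using component_of_member[of \<alpha> x \<alpha>] component_of_member[of \<beta> x \<alpha>] assms by auto

lemma inj_on_summands:
  assumes "\<And>\<alpha>. \<alpha> \<in> \<Gamma> \<Longrightarrow> F \<alpha> \<noteq> {0}"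
  shows "inj_on F \<Gamma>"
proof (rule inj_onI)
  fix \<alpha> \<beta> assume "\<alpha> \<in> \<Gamma>" "\<beta> \<in> \<Gamma>" "F \<alpha> = F \<beta>"
  moreover have "0 \<in> F \<alpha>" by (rule subspace_0[OF summand_subspace[OF \<open>\<alpha> \<in> \<Gamma>\<close>]])
  ultimately show "\<alpha> = \<beta>"
    using summands_meet_trivially[of \<alpha> \<beta>] assms[of \<alpha>] by blast
qed

text \<open>By uniqueness of components, applying \<open>h\<close> componentwise computes the components of
  \<open>h x\<close>. Scalar multiplications and multiplications by a fixed element are the instances that
  make the projections linear and multipliers.\<close>

lemma component_commutes:
  assumes "additive h" and pres: "\<And>\<gamma> y. \<gamma> \<in> \<Gamma> \<Longrightarrow> y \<in> F \<gamma> \<Longrightarrow> h y \<in> F \<gamma>"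
  shows "component \<alpha> (h x) = h (component \<alpha> x)"
proof -
  interpret h: additive h by fact
  let ?u = "\<lambda>\<gamma>. h (component \<gamma> x)"
  have sub: "{\<gamma>. ?u \<gamma> \<noteq> 0} \<subseteq> {\<gamma>. component \<gamma> x \<noteq> 0}"
    using h.zero by auto
  have "h x = (\<Sum>\<gamma> | component \<gamma> x \<noteq> 0. ?u \<gamma>)"
    by (simp add: sum_components flip: h.sum)
  also have "\<dots> = (\<Sum>\<gamma> | ?u \<gamma> \<noteq> 0. ?u \<gamma>)"
    by (rule sum.mono_neutral_right[OF finite_support sub]) auto
  finally have "components_of (h x) ?u"
    unfolding components_of_def
    using pres component_in_summand component_outside h.zero
      finite_subset[OF sub finite_support] by auto
  then show ?thesis by (rule component_eqI)
qed

lemma component_add: "component \<alpha> (x + y) = component \<alpha> x + component \<alpha> y"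
proof -
  let ?u = "\<lambda>\<gamma>. component \<gamma> x + component \<gamma> y"
  let ?S = "{\<gamma>. component \<gamma> x \<noteq> 0} \<union> {\<gamma>. component \<gamma> y \<noteq> 0}"
  have fin: "finite ?S" using finite_support by blast
  have sub: "{\<gamma>. ?u \<gamma> \<noteq> 0} \<subseteq> ?S" by auto
  have sum_S: "(\<Sum>\<gamma>\<in>?S. component \<gamma> z) = z" if "z \<in> {x, y}" for z
  proof -
    have "(\<Sum>\<gamma>\<in>?S. component \<gamma> z) = (\<Sum>\<gamma> | component \<gamma> z \<noteq> 0. component \<gamma> z)"
      using that by (intro sum.mono_neutral_right[OF fin]) auto
    then show ?thesis by (simp add: sum_components)
  qed
  have "x + y = (\<Sum>\<gamma>\<in>?S. ?u \<gamma>)"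
    by (simp add: sum.distrib sum_S)
  also have "\<dots> = (\<Sum>\<gamma> | ?u \<gamma> \<noteq> 0. ?u \<gamma>)"
    by (rule sum.mono_neutral_right[OF fin sub]) auto
  finally have "components_of (x + y) ?u"
    unfolding components_of_def
    using component_in_summand component_outside finite_subset[OF sub fin]
      subspace_add[OF summand_subspace] by auto
  then show ?thesis by (rule component_eqI)
qed

lemma additive_component: "additive (component \<alpha>)"
  by standard (rule component_add)

lemma component_scale: "component \<alpha> (scale c x) = scale c (component \<alpha> x)"
  by (rule component_commutes)
    (auto intro: additive.intro simp: scale_right_distrib subspace_scale[OF summand_subspace])

lemma additive_mult_left: "additive (\<lambda>x. mult x y)"
  and additive_mult_right: "additive (mult x)"
  using linear_mult_left[of y] linear_mult_right[of x]
  by (auto intro: additive.intro simp: Vector_Spaces.linear_iff)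

lemma component_mult_left: "component \<alpha> (mult x y) = mult (component \<alpha> x) y"
  by (rule component_commutes[OF additive_mult_left]) (rule summand_mult_left)

lemma component_mult_right: "component \<alpha> (mult x y) = mult x (component \<alpha> y)"
  by (rule component_commutes[OF additive_mult_right]) (rule summand_mult_right)

lemma mem_summandI:
  assumes "\<alpha> \<in> \<Gamma>" and zero: "\<And>\<gamma>. \<gamma> \<noteq> \<alpha> \<Longrightarrow> component \<gamma> x = 0"
  shows "x \<in> F \<alpha>"
proof -
  have "(\<Sum>\<gamma> | component \<gamma> x \<noteq> 0. component \<gamma> x) = (\<Sum>\<gamma>\<in>{\<alpha>}. component \<gamma> x)"
    using zero by (intro sum.mono_neutral_left) auto
  then have "x = component \<alpha> x" by (simp add: sum_components)
  then show ?thesis using component_in_summand[OF \<open>\<alpha> \<in> \<Gamma>\<close>] by metis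
qed

lemma ex_nonzero_component:
  assumes "x \<noteq> 0"
  obtains \<alpha> where "\<alpha> \<in> \<Gamma>" "component \<alpha> x \<noteq> 0"
proof -
  have "\<exists>\<alpha>. component \<alpha> x \<noteq> 0"
  proof (rule ccontr)
    assume "\<not> ?thesis"
    then have "x = 0" using sum_components[of x] by simp
    with assms show False by simp
  qed
  then show thesis using that component_outside by blast
qed

section \<open>Multipliers and indecomposable ideals\<close>

text \<open>For \<open>\<gamma> \<noteq> \<alpha>\<close>, the component \<open>p\<^sub>\<gamma> (T x)\<close> times any \<open>y\<close> is
  \<open>p\<^sub>\<gamma> (x T(y))\<close>, which vanishes since \<open>x T(y)\<close> stays in the ideal \<open>F \<alpha>\<close>. So that component
  lies in the annihilator.\<close>

lemma multiplier_preserves_summand: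
  assumes ann: "annihilator mult = {0}"
    and left: "\<And>x y. mult (T x) y = mult x (T y)"
    and right: "\<And>x y. mult y (T x) = mult (T y) x"
    and "\<alpha> \<in> \<Gamma>" "x \<in> F \<alpha>"
  shows "T x \<in> F \<alpha>"
proof (rule mem_summandI[OF \<open>\<alpha> \<in> \<Gamma>\<close>])
  fix \<gamma> assume "\<gamma> \<noteq> \<alpha>"
  have "mult (component \<gamma> (T x)) y = 0" for y
    using component_of_member[OF \<open>\<alpha> \<in> \<Gamma>\<close> summand_mult_left[OF \<open>\<alpha> \<in> \<Gamma>\<close> \<open>x \<in> F \<alpha>\<close>]] \<open>\<gamma> \<noteq> \<alpha>\<close>
    by (simp add: left flip: component_mult_left)
  moreover have "mult y (component \<gamma> (T x)) = 0" for y
    using component_of_member[OF \<open>\<alpha> \<in> \<Gamma>\<close> summand_mult_right[OF \<open>\<alpha> \<in> \<Gamma>\<close> \<open>x \<in> F \<alpha>\<close>]] \<open>\<gamma> \<noteq> \<alpha>\<close>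
    by (simp add: right flip: component_mult_right)
  ultimately show "component \<gamma> (T x) = 0"
    using ann unfolding annihilator_def by blast
qed

text \<open>Choose a summand \<open>F \<beta>\<close> whose projection does not vanish on \<open>I\<close>. The
  projection splits \<open>I\<close> into its image \<open>I \<inter> F \<beta>\<close> and its kernel on \<open>I\<close>; the image is nonzero, so
  indecomposability forces the kernel to be zero.\<close>

lemma indecomposable_ideal_in_summand:
  assumes I: "alg_ideal scale mult UNIV I" and "\<not> decomposable scale mult I" and "I \<noteq> {0}"
    and pres: "\<And>\<beta> x. \<beta> \<in> \<Gamma> \<Longrightarrow> x \<in> I \<Longrightarrow> component \<beta> x \<in> I"
  obtains \<beta> where "\<beta> \<in> \<Gamma>" "I \<subseteq> F \<beta>"
proof -
  have sub: "subspace I" and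
    mult_I: "\<And>x y. x \<in> I \<Longrightarrow> mult x y \<in> I" "\<And>x y. x \<in> I \<Longrightarrow> mult y x \<in> I"
    using I unfolding alg_ideal_def by auto
  obtain x where x: "x \<in> I" "x \<noteq> 0"
    using \<open>I \<noteq> {0}\<close> subspace_0[OF sub] by blast
  obtain \<beta> where \<beta>: "\<beta> \<in> \<Gamma>" "component \<beta> x \<noteq> 0"
    by (rule ex_nonzero_component[OF \<open>x \<noteq> 0\<close>])
  interpret q: additive "component \<beta>" by (rule additive_component)
  define J where "J = {y \<in> I. component \<beta> y = 0}"
  have image: "component \<beta> y \<in> I \<inter> F \<beta>" if "y \<in> I" for y
    using that pres \<beta>(1) component_in_summand by auto
  have kernel: "y - component \<beta> y \<in> J" if "y \<in> I" for y
    using that image[OF that] component_of_member[OF \<beta>(1)] subspace_diff[OF sub]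
    by (auto simp: J_def q.diff)
  have "alg_ideal scale mult I (I \<inter> F \<beta>)"
    using subspace_inter[OF sub summand_subspace[OF \<beta>(1)]] mult_I
      summand_mult_left[OF \<beta>(1)] summand_mult_right[OF \<beta>(1)]
    unfolding alg_ideal_def by auto
  moreover have "alg_ideal scale mult I J"
    unfolding alg_ideal_def
  proof (intro conjI ballI)
    show "J \<subseteq> I" by (auto simp: J_def)
    show "subspace J"
      using sub unfolding subspace_def J_def by (auto simp: q.zero component_add component_scale)
    fix y c assume "y \<in> J"
    then have y: "y \<in> I" "component \<beta> y = 0" by (auto simp: J_def)
    show "mult y c \<in> J"
      using y mult_I additive.zero[OF additive_mult_left]
      by (simp add: J_def component_mult_left)
    show "mult c y \<in> J"
      using y mult_I additive.zero[OF additive_mult_right]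
      by (simp add: J_def component_mult_right)
  qed
  moreover have "I \<inter> F \<beta> \<noteq> {0}" using image[OF x(1)] \<beta>(2) by blast
  moreover have "I = {y + z | y z. y \<in> I \<inter> F \<beta> \<and> z \<in> J}" (is "_ = ?S")
  proof
    show "?S \<subseteq> I" using subspace_add[OF sub] by (auto simp: J_def)
    show "I \<subseteq> ?S"
    proof
      fix y assume "y \<in> I"
      then have "y = component \<beta> y + (y - component \<beta> y)" by simp
      then show "y \<in> ?S" using image[OF \<open>y \<in> I\<close>] kernel[OF \<open>y \<in> I\<close>] by blast
    qed
  qed
  moreover have "(I \<inter> F \<beta>) \<inter> J = {0}"
    using subspace_0[OF sub] subspace_0[OF summand_subspace[OF \<beta>(1)]] component_of_member[OF \<beta>(1)]
    by (auto simp: J_def q.zero)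
  ultimately have "J \<noteq> {0} \<Longrightarrow> decomposable scale mult I"
    unfolding decomposable_def by (intro exI[of _ "I \<inter> F \<beta>"] exI[of _ J] conjI)
  with \<open>\<not> decomposable scale mult I\<close> have "J = {0}" by blast
  have "I \<subseteq> F \<beta>"
  proof
    fix y assume "y \<in> I"
    then have "y = component \<beta> y" using kernel \<open>J = {0}\<close> by fastforce
    then show "y \<in> F \<beta>" using component_in_summand[OF \<beta>(1)] by metis
  qed
  with \<beta>(1) show thesis by (rule that)
qed

end

section \<open>Comparing two decompositions\<close>

lemma summand_in_summand:
  assumes "ideal_decomposition scale mult \<Gamma> F" and "ideal_decomposition scale mult \<Delta> G"
    and ann: "annihilator mult = {0}"
    and "\<alpha> \<in> \<Gamma>" "F \<alpha> \<noteq> {0}" "\<not> decomposable scale mult (F \<alpha>)"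
  obtains \<beta> where "\<beta> \<in> \<Delta>" "F \<alpha> \<subseteq> G \<beta>"
proof -
  interpret F: ideal_decomposition scale mult \<Gamma> F by fact
  interpret G: ideal_decomposition scale mult \<Delta> G by fact
  have "G.component \<beta> x \<in> F \<alpha>" if "x \<in> F \<alpha>" for \<beta> x
    by (rule F.multiplier_preserves_summand[OF ann _ _ \<open>\<alpha> \<in> \<Gamma>\<close> that])
      (simp_all flip: G.component_mult_left G.component_mult_right)
  then show thesis
    using G.indecomposable_ideal_in_summand F.ideal assms that by metis
qed

lemma summand_eq_summand:
  assumes F: "ideal_decomposition scale mult \<Gamma> F" and G: "ideal_decomposition scale mult \<Delta> G"
    and ann: "annihilator mult = {0}"
    and F_indec: "\<And>\<alpha>. \<alpha> \<in> \<Gamma> \<Longrightarrow> F \<alpha> \<noteq> {0} \<and> \<not> decomposable scale mult (F \<alpha>)"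
    and G_indec: "\<And>\<beta>. \<beta> \<in> \<Delta> \<Longrightarrow> G \<beta> \<noteq> {0} \<and> \<not> decomposable scale mult (G \<beta>)"
    and "\<alpha> \<in> \<Gamma>"
  obtains \<beta> where "\<beta> \<in> \<Delta>" "F \<alpha> = G \<beta>"
proof -
  interpret F: ideal_decomposition scale mult \<Gamma> F by fact
  obtain \<beta> where \<beta>: "\<beta> \<in> \<Delta>" "F \<alpha> \<subseteq> G \<beta>"
    using summand_in_summand[OF F G ann] F_indec \<open>\<alpha> \<in> \<Gamma>\<close> by metis
  obtain \<delta> where \<delta>: "\<delta> \<in> \<Gamma>" "G \<beta> \<subseteq> F \<delta>"
    using summand_in_summand[OF G F ann] G_indec \<beta>(1) by metis
  obtain x where "x \<in> F \<alpha>" "x \<noteq> 0"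
    using F_indec[OF \<open>\<alpha> \<in> \<Gamma>\<close>] F.subspace_0[OF F.summand_subspace[OF \<open>\<alpha> \<in> \<Gamma>\<close>]] by blast
  then have "\<delta> = \<alpha>"
    using F.summands_meet_trivially[of \<alpha> \<delta> x] \<open>\<alpha> \<in> \<Gamma>\<close> \<beta>(2) \<delta> by blast
  then have "F \<alpha> = G \<beta>" using \<beta>(2) \<delta>(2) by simp
  with \<beta>(1) show thesis by (rule that)
qed

text \<open>The field contains the distinct elements \<open>0\<close> and \<open>1\<close>, but all extensional maps
  \<open>{0} \<rightarrow> {0}\<close> are equal.\<close>

lemma nonzero_if_centroid_field:
  fixes scale :: "'k::field \<Rightarrow> 'a::ab_group_add \<Rightarrow> 'a"
  assumes "alg_isomorphic (centroid_alg scale mult C) (field_alg :: ('k, 'k) alg)"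
  shows "C \<noteq> {0}"
proof
  assume "C = {0}"
  obtain f :: "('a \<Rightarrow> 'a) \<Rightarrow> 'k" where "bij_betw f (centroid scale mult C) UNIV"
    using assms unfolding alg_isomorphic_def centroid_alg_def field_alg_def by auto
  then have surj: "f ` centroid scale mult C = UNIV" by (rule bij_betw_imp_surj_on)
  have "S = T" if "S \<in> centroid scale mult C" "T \<in> centroid scale mult C" for S T
  proof (rule PiE_ext[where k = C and s = "\<lambda>_. C"])
    show ST: "S \<in> C \<rightarrow>\<^sub>E C" "T \<in> C \<rightarrow>\<^sub>E C" using that by (auto simp: centroid_def)
    show "S x = T x" if "x \<in> C" for x
      using PiE_mem[OF ST(1) that] PiE_mem[OF ST(2) that] \<open>C = {0}\<close> by simp
  qed
  moreover obtain S T where "S \<in> centroid scale mult C" "f S = 0" "T \<in> centroid scale mult C" "f T = 1"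
    using surj by (metis UNIV_I imageE)
  ultimately show False by (metis zero_neq_one)
qed

lemma alg_isomorphic_refl: "alg_isomorphic X X"
  unfolding alg_isomorphic_def by (rule exI[of _ "\<lambda>x. x"]) (simp add: bij_betw_def)

theorem theorem4p7:
  fixes scale :: "'k::field \<Rightarrow> 'a::ab_group_add \<Rightarrow> 'a"
    and mult :: "'a \<Rightarrow> 'a \<Rightarrow> 'a"
    and \<Gamma> :: "'i set" and \<Gamma>' :: "'j set"
    and A :: "'i \<Rightarrow> 'a set" and A' :: "'j \<Rightarrow> 'a set"
  assumes "evolution_algebra scale mult"
    and "annihilator mult = {0}"
    and "\<forall>\<alpha>\<in>\<Gamma>. alg_ideal scale mult UNIV (A \<alpha>)"
    and "is_direct_sum \<Gamma> A"
    and "\<forall>\<alpha>\<in>\<Gamma>. \<not> decomposable scale mult (A \<alpha>)"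
    and "\<forall>\<alpha>\<in>\<Gamma>. alg_isomorphic (centroid_alg scale mult (A \<alpha>)) (field_alg :: ('k, 'k) alg)"
    and "\<forall>\<beta>\<in>\<Gamma>'. alg_ideal scale mult UNIV (A' \<beta>)"
    and "is_direct_sum \<Gamma>' A'"
    and "\<forall>\<beta>\<in>\<Gamma>'. \<not> decomposable scale mult (A' \<beta>)"
    and "\<forall>\<beta>\<in>\<Gamma>'. alg_isomorphic (centroid_alg scale mult (A' \<beta>)) (field_alg :: ('k, 'k) alg)"
  shows "\<exists>\<sigma>. bij_betw \<sigma> \<Gamma> \<Gamma>' \<and>
           (\<forall>\<alpha>\<in>\<Gamma>. alg_isomorphic (sub_alg scale mult (A \<alpha>)) (sub_alg scale mult (A' (\<sigma> \<alpha>))))"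
proof -
  interpret evolution_algebra scale mult by fact
  have dec: "ideal_decomposition scale mult \<Gamma> A"
    by unfold_locales (use assms in auto)
  have dec': "ideal_decomposition scale mult \<Gamma>' A'"
    by unfold_locales (use assms in auto)
  have indec: "A \<alpha> \<noteq> {0} \<and> \<not> decomposable scale mult (A \<alpha>)" if "\<alpha> \<in> \<Gamma>" for \<alpha>
    using that assms nonzero_if_centroid_field by metis
  have indec': "A' \<beta> \<noteq> {0} \<and> \<not> decomposable scale mult (A' \<beta>)" if "\<beta> \<in> \<Gamma>'" for \<beta>
    using that assms nonzero_if_centroid_field by metis
  have inj: "inj_on A \<Gamma>" and inj': "inj_on A' \<Gamma>'"
    using indec indec' by (simp_all add: ideal_decomposition.inj_on_summands[OF dec]
        ideal_decomposition.inj_on_summands[OF dec'])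
  have "A ` \<Gamma> = A' ` \<Gamma>'"
  proof
    show "A ` \<Gamma> \<subseteq> A' ` \<Gamma>'"
      using summand_eq_summand[OF dec dec' assms(2) indec indec'] by blast
    show "A' ` \<Gamma>' \<subseteq> A ` \<Gamma>"
      using summand_eq_summand[OF dec' dec assms(2) indec' indec] by blast
  qed
  then have "bij_betw A \<Gamma> (A' ` \<Gamma>')"
    using inj by (simp add: bij_betw_def)
  then have bij: "bij_betw (inv_into \<Gamma>' A' \<circ> A) \<Gamma> \<Gamma>'"
    by (rule bij_betw_trans) (rule bij_betw_inv_into[OF inj_on_imp_bij_betw[OF inj']])
  moreover have "A' ((inv_into \<Gamma>' A' \<circ> A) \<alpha>) = A \<alpha>" if "\<alpha> \<in> \<Gamma>" for \<alpha>
    using that \<open>A ` \<Gamma> = A' ` \<Gamma>'\<close> by (metis comp_apply f_inv_into_f imageI)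
  ultimately show ?thesis
    by (metis alg_isomorphic_refl)
qed

end
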